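(* Suppose $G$ is a countable group that is the union of a strictly increasing sequence of its finite subgroups $\{G_i\}_{i\ge 1}$. There is a proper integral ultrametric $d_G$ on $G$ such that $(G,d_G)$ is a universal space in the category of metric spaces of bounded geometry that have asymptotic dimension $0$; that is, $(G,d_G)$ has bounded geometry and asymptotic dimension $0$, and every metric space of bounded geometry and asymptotic dimension $0$ coarsely embeds in $(G,d_G)$.
   Context: An integral ultrametric on a set is a metric $d$ taking only non-negative integer values and satisfying $d(x,z)\le\max\{d(x,y),d(y,z)\}$ for all $x,y,z$. It is proper if closed bounded subsets are compact. A metric space $X$ has bounded geometry if there are $\varepsilon>0$ and a function $c:[0,\infty)\to[0,\infty)$ such that for every $x\in X$ and $t\ge 0$, every subset of the ball of radius $t$ about $x$ whose distinct points are at mutual distance at least $\varepsilon$ has at most $c(t)$ elements. A metric space $X$ is of asymptotic dimension $0$ if for every uniformly bounded cover $\mathcal U$ of $X$ there is a uniformly bounded cover $\mathcal V$ of $X$ whose elements are pairwise disjoint and such that $\mathcal U$ refines $\mathcal V$ (every element of $\mathcal U$ is contained in some element of $\mathcal V$). A function $f:(X,d_1)\to(Y,d_2)$ is uniformly bornologous if for all $R>0$ there is $S>0$ such that $d_1(x,y)\le R$ implies $d_2(f(x),f(y))\le S$. It is uniformly proper if for every $R>0$ there is $S>0$ such that whenever $B\subseteq Y$ has diameter at most $R$, $f^{-1}(B)$ has diameter at most $S$. A coarse embedding is a function that is uniformly bornologous and uniformly proper; $X$ coarsely embeds in $Y$ if there is a coarse embedding $X\to Y$. *)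

theory Defs
  imports "HOL-Analysis.Analysis" "HOL-Algebra.Group"
begin

definition integral_ultrametric :: "'a set \<Rightarrow> ('a \<Rightarrow> 'a \<Rightarrow> real) \<Rightarrow> bool" where
  "integral_ultrametric M d \<longleftrightarrow>
     Metric_space M d \<and>
     (\<forall>x\<in>M. \<forall>y\<in>M. d x y \<in> \<nat>) \<and>
     (\<forall>x\<in>M. \<forall>y\<in>M. \<forall>z\<in>M. d x z \<le> max (d x y) (d y z))"

definition proper_metric :: "'a set \<Rightarrow> ('a \<Rightarrow> 'a \<Rightarrow> real) \<Rightarrow> bool" where
  "proper_metric M d \<longleftrightarrow>
     (\<forall>B. closedin (Metric_space.mtopology M d) B \<and> Metric_space.mbounded M d B
        \<longrightarrow> compactin (Metric_space.mtopology M d) B)"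

text \<open>Balls are closed; with open balls one gets an equivalent notion, with a different \<open>c\<close>.
  Finiteness of \<open>S\<close> is required explicitly because an infinite set has cardinality \<open>0\<close>.\<close>

definition bounded_geometry :: "'a set \<Rightarrow> ('a \<Rightarrow> 'a \<Rightarrow> real) \<Rightarrow> bool" where
  "bounded_geometry M d \<longleftrightarrow>
     (\<exists>\<epsilon>>0. \<exists>c :: real \<Rightarrow> real. (\<forall>t\<ge>0. 0 \<le> c t) \<and>
        (\<forall>x\<in>M. \<forall>t\<ge>0. \<forall>S.
           S \<subseteq> Metric_space.mcball M d x t \<and> (\<forall>a\<in>S. \<forall>b\<in>S. a \<noteq> b \<longrightarrow> \<epsilon> \<le> d a b)
             \<longrightarrow> finite S \<and> real (card S) \<le> c t))"

definition diameter_le :: "('a \<Rightarrow> 'a \<Rightarrow> real) \<Rightarrow> 'a set \<Rightarrow> real \<Rightarrow> bool" where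
  "diameter_le d B R \<longleftrightarrow> (\<forall>x\<in>B. \<forall>y\<in>B. d x y \<le> R)"

definition uniformly_bounded_cover ::
    "'a set \<Rightarrow> ('a \<Rightarrow> 'a \<Rightarrow> real) \<Rightarrow> 'a set set \<Rightarrow> bool" where
  "uniformly_bounded_cover M d \<U> \<longleftrightarrow> \<Union>\<U> = M \<and> (\<exists>R. \<forall>U\<in>\<U>. diameter_le d U R)"

definition refines :: "'a set set \<Rightarrow> 'a set set \<Rightarrow> bool" where
  "refines \<U> \<V> \<longleftrightarrow> (\<forall>U\<in>\<U>. \<exists>V\<in>\<V>. U \<subseteq> V)"

definition asdim_0 :: "'a set \<Rightarrow> ('a \<Rightarrow> 'a \<Rightarrow> real) \<Rightarrow> bool" where
  "asdim_0 M d \<longleftrightarrow>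
     (\<forall>\<U>. uniformly_bounded_cover M d \<U> \<longrightarrow>
        (\<exists>\<V>. uniformly_bounded_cover M d \<V> \<and> disjoint \<V> \<and> refines \<U> \<V>))"

definition uniformly_bornologous ::
    "'a set \<Rightarrow> ('a \<Rightarrow> 'a \<Rightarrow> real) \<Rightarrow> ('b \<Rightarrow> 'b \<Rightarrow> real) \<Rightarrow> ('a \<Rightarrow> 'b) \<Rightarrow> bool" where
  "uniformly_bornologous X d1 d2 f \<longleftrightarrow>
     (\<forall>R>0. \<exists>S>0. \<forall>x\<in>X. \<forall>y\<in>X. d1 x y \<le> R \<longrightarrow> d2 (f x) (f y) \<le> S)"

definition uniformly_proper ::
    "'a set \<Rightarrow> ('a \<Rightarrow> 'a \<Rightarrow> real) \<Rightarrow> 'b set \<Rightarrow> ('b \<Rightarrow> 'b \<Rightarrow> real) \<Rightarrow> ('a \<Rightarrow> 'b) \<Rightarrow> bool" where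
  "uniformly_proper X d1 Y d2 f \<longleftrightarrow>
     (\<forall>R>0. \<exists>S>0. \<forall>B\<subseteq>Y. diameter_le d2 B R \<longrightarrow> diameter_le d1 (f -` B \<inter> X) S)"

definition coarse_embedding ::
    "'a set \<Rightarrow> ('a \<Rightarrow> 'a \<Rightarrow> real) \<Rightarrow> 'b set \<Rightarrow> ('b \<Rightarrow> 'b \<Rightarrow> real) \<Rightarrow> ('a \<Rightarrow> 'b) \<Rightarrow> bool" where
  "coarse_embedding X d1 Y d2 f \<longleftrightarrow>
     f \<in> X \<rightarrow> Y \<and> uniformly_bornologous X d1 d2 f \<and> uniformly_proper X d1 Y d2 f"

definition coarsely_embeds ::
    "'a set \<Rightarrow> ('a \<Rightarrow> 'a \<Rightarrow> real) \<Rightarrow> 'b set \<Rightarrow> ('b \<Rightarrow> 'b \<Rightarrow> real) \<Rightarrow> bool" where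
  "coarsely_embeds X d1 Y d2 \<longleftrightarrow> (\<exists>f. coarse_embedding X d1 Y d2 f)"

text \<open>The first argument fixes the type whose subsets serve as carriers of the spaces to be
  embedded. The notion ``universal'' of the mathematical text is \<open>universal_space\<close> at every
  type \<open>'b\<close>. The quantifier over types cannot be placed under an existential quantifier for
  \<open>d\<close>. To obtain one \<open>d\<close> that is good for all types, one asserts the existence of a \<open>d\<close> that
  is universal at type \<open>nat\<close>, together with the fact that each such \<open>d\<close> is universal at every
  \<open>'b\<close>; the latter holds because a space of bounded geometry contains a countable net, and
  this net carries the coarse structure of the space.\<close>

definition universal_space :: "'b itself \<Rightarrow> 'a set \<Rightarrow> ('a \<Rightarrow> 'a \<Rightarrow> real) \<Rightarrow> bool" where
  "universal_space (_ :: 'b itself) M d \<longleftrightarrow>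
     bounded_geometry M d \<and> asdim_0 M d \<and>
     (\<forall>(X :: 'b set) \<delta>. Metric_space X \<delta> \<and> bounded_geometry X \<delta> \<and> asdim_0 X \<delta>
        \<longrightarrow> coarsely_embeds X \<delta> M d)"

end

theory Submission
  imports Defs "HOL-Algebra.Coset"
begin

text \<open>
  Let \<open>K 0 = {\<one>} \<subset> K 1 \<subset> K 2 \<subset> \<dots>\<close> be finite subgroups with union \<open>G\<close>, and let \<open>d x y\<close> be
  the least \<open>n\<close> with \<open>x\<inverse> y \<in> K n\<close>. Being at distance at most \<open>n\<close> means lying in the same left
  coset of \<open>K n\<close>, so \<open>d\<close> is an integral ultrametric, its balls are finite cosets of bounded size
  (hence it is proper and has bounded geometry), and the partition into cosets of \<open>K n\<close> witnesses
  asymptotic dimension \<open>0\<close>.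

  For universality, a space \<open>X\<close> of asymptotic dimension \<open>0\<close> carries an increasing sequence of
  equivalence relations \<open>E k\<close> with uniformly bounded classes such that any two points at distance
  at most \<open>k\<close> are \<open>E k\<close>-related (\<open>asdim_0_filtration\<close>). This sequence determines the coarse
  structure of \<open>X\<close>. If \<open>X\<close> has bounded geometry, the number of \<open>E k\<close>-classes in an
  \<open>E (k+1)\<close>-class is at most some \<open>N k\<close> (\<open>coarse_filtration\<close>). Since the indices of the subgroups
  \<open>K n\<close> in each other grow without bound, a subsequence \<open>L k = K (idx k)\<close> has the index of \<open>L k\<close>
  in \<open>L (k+1)\<close> at least \<open>N k\<close>. One can therefore label the \<open>E k\<close>-classes inside each
  \<open>E (k+1)\<close>-class by elements of \<open>L (k+1)\<close> from different cosets of \<open>L k\<close>. Mapping a point to the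
  product of its labels, the highest level leftmost, gives a map \<open>f\<close> for which \<open>x\<close> and \<open>y\<close> are
  \<open>E k\<close>-related exactly if \<open>f x\<close> and \<open>f y\<close> lie in the same coset of \<open>L k\<close>
  (\<open>filtration_embedding\<close>); such a map is a coarse embedding. The product is finite because the
  labels are normalised to be \<open>\<one>\<close> along a base point, to which every point is \<open>E k\<close>-related for
  large \<open>k\<close>.

  This argument works for \<open>X\<close> of any type. Given another ultrametric \<open>d'\<close> on \<open>G\<close> that is only
  known to be universal for spaces of natural numbers, transport \<open>(G, d)\<close> to such a space along
  an enumeration of \<open>G\<close>: it then embeds coarsely into \<open>(G, d')\<close>, and so does every \<open>X\<close>, by way
  of \<open>(G, d)\<close>.
\<close>

section \<open>Coarse embeddings and pullback metrics\<close>

text \<open>Preimages of bounded sets are controlled by preimages of two-point sets \<open>{f x, f y}\<close>.\<close>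

lemma uniformly_proper_iff:
  assumes "Metric_space Y d2" and "f \<in> X \<rightarrow> Y"
  shows "uniformly_proper X d1 Y d2 f \<longleftrightarrow>
    (\<forall>R>0. \<exists>S>0. \<forall>x\<in>X. \<forall>y\<in>X. d2 (f x) (f y) \<le> R \<longrightarrow> d1 x y \<le> S)"
proof
  assume up: "uniformly_proper X d1 Y d2 f"
  show "\<forall>R>0. \<exists>S>0. \<forall>x\<in>X. \<forall>y\<in>X. d2 (f x) (f y) \<le> R \<longrightarrow> d1 x y \<le> S"
  proof (intro allI impI)
    fix R :: real assume "R > 0"
    then obtain S where S: "S > 0" "\<And>B. B \<subseteq> Y \<Longrightarrow> diameter_le d2 B R \<Longrightarrow> diameter_le d1 (f -` B \<inter> X) S"
      using up unfolding uniformly_proper_def by blast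
    have "d1 x y \<le> S" if "x \<in> X" "y \<in> X" "d2 (f x) (f y) \<le> R" for x y
    proof -
      have Y: "f x \<in> Y" "f y \<in> Y"
        using that assms(2) by auto
      then have "diameter_le d2 {f x, f y} R"
        using that \<open>R > 0\<close> Metric_space.commute[OF assms(1), of "f x" "f y"]
          Metric_space.mdist_zero[OF assms(1)] by (auto simp: diameter_le_def)
      with S(2)[of "{f x, f y}"] Y that show ?thesis
        by (auto simp: diameter_le_def)
    qed
    with S(1) show "\<exists>S>0. \<forall>x\<in>X. \<forall>y\<in>X. d2 (f x) (f y) \<le> R \<longrightarrow> d1 x y \<le> S"
      by blast
  qed
next
  assume *: "\<forall>R>0. \<exists>S>0. \<forall>x\<in>X. \<forall>y\<in>X. d2 (f x) (f y) \<le> R \<longrightarrow> d1 x y \<le> S"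
  show "uniformly_proper X d1 Y d2 f"
    unfolding uniformly_proper_def
  proof (intro allI impI)
    fix R :: real assume "R > 0"
    then obtain S where "S > 0" "\<forall>x\<in>X. \<forall>y\<in>X. d2 (f x) (f y) \<le> R \<longrightarrow> d1 x y \<le> S"
      using * by blast
    then show "\<exists>S>0. \<forall>B\<subseteq>Y. diameter_le d2 B R \<longrightarrow> diameter_le d1 (f -` B \<inter> X) S"
      by (intro exI[of _ S]) (auto simp: diameter_le_def)
  qed
qed

lemma coarsely_embeds_trans:
  assumes Y: "Metric_space Y d2" and Z: "Metric_space Z d3"
    and "coarsely_embeds X d1 Y d2" and "coarsely_embeds Y d2 Z d3"
  shows "coarsely_embeds X d1 Z d3"
proof -
  obtain f g where f: "f \<in> X \<rightarrow> Y" "uniformly_bornologous X d1 d2 f" "uniformly_proper X d1 Y d2 f"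
    and g: "g \<in> Y \<rightarrow> Z" "uniformly_bornologous Y d2 d3 g" "uniformly_proper Y d2 Z d3 g"
    using assms(3,4) unfolding coarsely_embeds_def coarse_embedding_def by blast
  have gf: "g \<circ> f \<in> X \<rightarrow> Z"
    using f(1) g(1) by auto
  have "uniformly_bornologous X d1 d3 (g \<circ> f)"
    unfolding uniformly_bornologous_def
  proof (intro allI impI)
    fix R :: real assume "R > 0"
    then obtain S where S: "S > 0" "\<forall>x\<in>X. \<forall>y\<in>X. d1 x y \<le> R \<longrightarrow> d2 (f x) (f y) \<le> S"
      using f(2) unfolding uniformly_bornologous_def by blast
    then obtain T where T: "T > 0" "\<forall>x\<in>Y. \<forall>y\<in>Y. d2 x y \<le> S \<longrightarrow> d3 (g x) (g y) \<le> T"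
      using g(2) unfolding uniformly_bornologous_def by blast
    have "\<forall>x\<in>X. \<forall>y\<in>X. d1 x y \<le> R \<longrightarrow> d3 ((g \<circ> f) x) ((g \<circ> f) y) \<le> T"
      using S T f(1) by (simp add: Pi_iff)
    with T(1) show "\<exists>S>0. \<forall>x\<in>X. \<forall>y\<in>X. d1 x y \<le> R \<longrightarrow> d3 ((g \<circ> f) x) ((g \<circ> f) y) \<le> S"
      by blast
  qed
  moreover have "uniformly_proper X d1 Z d3 (g \<circ> f)"
    unfolding uniformly_proper_iff[OF Z gf]
  proof (intro allI impI)
    fix R :: real assume "R > 0"
    then obtain S where S: "S > 0" "\<forall>x\<in>Y. \<forall>y\<in>Y. d3 (g x) (g y) \<le> R \<longrightarrow> d2 x y \<le> S"
      using g(3) unfolding uniformly_proper_iff[OF Z g(1)] by blast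
    then obtain T where T: "T > 0" "\<forall>x\<in>X. \<forall>y\<in>X. d2 (f x) (f y) \<le> S \<longrightarrow> d1 x y \<le> T"
      using f(3) unfolding uniformly_proper_iff[OF Y f(1)] by blast
    have "\<forall>x\<in>X. \<forall>y\<in>X. d3 ((g \<circ> f) x) ((g \<circ> f) y) \<le> R \<longrightarrow> d1 x y \<le> T"
      using S T f(1) by (simp add: Pi_iff)
    with T(1) show "\<exists>S>0. \<forall>x\<in>X. \<forall>y\<in>X. d3 ((g \<circ> f) x) ((g \<circ> f) y) \<le> R \<longrightarrow> d1 x y \<le> S"
      by blast
  qed
  ultimately show ?thesis
    using gf unfolding coarsely_embeds_def coarse_embedding_def by blast
qed

lemma coarsely_embeds_isometry:
  assumes Y: "Metric_space Y d2" and f: "f \<in> X \<rightarrow> Y"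
    and "\<And>x y. x \<in> X \<Longrightarrow> y \<in> X \<Longrightarrow> d2 (f x) (f y) = d1 x y"
  shows "coarsely_embeds X d1 Y d2"
proof -
  have "uniformly_bornologous X d1 d2 f"
    unfolding uniformly_bornologous_def using assms(3) by auto
  moreover have "uniformly_proper X d1 Y d2 f"
    unfolding uniformly_proper_iff[OF Y f] using assms(3) by auto
  ultimately show ?thesis
    using f unfolding coarsely_embeds_def coarse_embedding_def by blast
qed

lemma Metric_space_pullback:
  assumes "Metric_space M d" and "g \<in> N \<rightarrow> M" and "inj_on g N"
  shows "Metric_space N (\<lambda>x y. d (g x) (g y))"
proof -
  interpret Metric_space M d by fact
  show ?thesis
  proof
    show "d (g x) (g y) = 0 \<longleftrightarrow> x = y" if "x \<in> N" "y \<in> N" for x y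
      using that assms(2) inj_on_eq_iff[OF assms(3) that] by (simp add: Pi_iff)
  qed (use assms(2) in \<open>auto simp: commute intro!: triangle\<close>)
qed

lemma bounded_geometry_pullback:
  assumes "Metric_space M d" and "g \<in> N \<rightarrow> M" and "inj_on g N" and "bounded_geometry M d"
  shows "bounded_geometry N (\<lambda>x y. d (g x) (g y))"
proof -
  interpret Metric_space M d by fact
  interpret N: Metric_space N "\<lambda>x y. d (g x) (g y)"
    by (rule Metric_space_pullback) fact+
  obtain \<epsilon> c where ec: "\<epsilon> > 0" "\<forall>t\<ge>0. 0 \<le> (c :: real \<Rightarrow> real) t"
    and c: "\<And>x t S. x \<in> M \<Longrightarrow> t \<ge> 0 \<Longrightarrow> S \<subseteq> mcball x t \<Longrightarrow>
           (\<forall>a\<in>S. \<forall>b\<in>S. a \<noteq> b \<longrightarrow> \<epsilon> \<le> d a b) \<Longrightarrow> finite S \<and> real (card S) \<le> c t"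
    using assms(4) unfolding bounded_geometry_def by metis
  have "finite S \<and> real (card S) \<le> c t"
    if "x \<in> N" "t \<ge> 0" and S: "S \<subseteq> N.mcball x t" "\<forall>a\<in>S. \<forall>b\<in>S. a \<noteq> b \<longrightarrow> \<epsilon> \<le> d (g a) (g b)"
    for x t S
  proof -
    have inj: "inj_on g S"
      by (rule inj_on_subset[OF assms(3)]) (use S(1) in auto)
    have "finite (g ` S) \<and> real (card (g ` S)) \<le> c t"
    proof (rule c)
      show "g x \<in> M" "g ` S \<subseteq> mcball (g x) t"
        using that S assms(2) by (auto simp: subset_iff)
    qed (use S \<open>t \<ge> 0\<close> in auto)
    then show ?thesis
      using finite_imageD[OF _ inj] card_image[OF inj] by simp
  qed
  with ec show ?thesis
    unfolding bounded_geometry_def by (intro exI[of _ \<epsilon>] exI[of _ c] conjI) simp_all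
qed

text \<open>A cover of \<open>N\<close> is pushed forward to \<open>M\<close>, where the singletons complete it to a cover; the
  disjoint cover of \<open>M\<close> that it refines is then pulled back.\<close>

lemma asdim_0_pullback:
  assumes "Metric_space M d" and "g \<in> N \<rightarrow> M" and "asdim_0 M d"
  shows "asdim_0 N (\<lambda>x y. d (g x) (g y))"
  unfolding asdim_0_def
proof (intro allI impI)
  fix \<U> assume "uniformly_bounded_cover N (\<lambda>x y. d (g x) (g y)) \<U>"
  then obtain R where U: "\<Union>\<U> = N" and R: "\<And>U. U \<in> \<U> \<Longrightarrow> diameter_le (\<lambda>x y. d (g x) (g y)) U R"
    unfolding uniformly_bounded_cover_def by blast
  let ?\<U> = "(`) g ` \<U> \<union> (\<lambda>x. {x}) ` M"
  have "uniformly_bounded_cover M d ?\<U>"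
    unfolding uniformly_bounded_cover_def
  proof
    show "\<Union>?\<U> = M"
      using U assms(2) by (auto simp: Pi_iff)
    have "\<forall>U\<in>?\<U>. diameter_le d U (max R 0)"
      using R Metric_space.mdist_zero[OF assms(1)] by (fastforce simp: diameter_le_def le_max_iff_disj)
    then show "\<exists>R. \<forall>U\<in>?\<U>. diameter_le d U R" ..
  qed
  then obtain \<V> where V: "uniformly_bounded_cover M d \<V>" "disjoint \<V>" "refines ?\<U> \<V>"
    using assms(3) unfolding asdim_0_def by blast
  let ?\<V> = "(\<lambda>V. g -` V \<inter> N) ` \<V>"
  have "uniformly_bounded_cover N (\<lambda>x y. d (g x) (g y)) ?\<V>"
    using V(1) assms(2) unfolding uniformly_bounded_cover_def diameter_le_def
    by (force simp: Pi_iff)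
  moreover have "disjoint ?\<V>"
    using V(2) unfolding disjoint_def by blast
  moreover have "refines \<U> ?\<V>"
    unfolding refines_def
  proof
    fix U assume "U \<in> \<U>"
    then obtain V where "V \<in> \<V>" "g ` U \<subseteq> V"
      using V(3) unfolding refines_def by blast
    moreover have "U \<subseteq> N"
      using \<open>U \<in> \<U>\<close> U by blast
    ultimately show "\<exists>V\<in>?\<V>. U \<subseteq> V"
      by (intro bexI[of _ "g -` V \<inter> N"]) auto
  qed
  ultimately show "\<exists>\<V>. uniformly_bounded_cover N (\<lambda>x y. d (g x) (g y)) \<V> \<and> disjoint \<V> \<and> refines \<U> \<V>"
    by blast
qed

section \<open>The ultrametric of a filtration by equivalence relations\<close>

text \<open>For the group \<open>E 0\<close> will be equality, which makes \<open>level_dist\<close> below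
  a metric, whereas for a general space it is a coarser relation that plays the role of a net.\<close>

locale equiv_filtration =
  fixes M :: "'a set" and E :: "nat \<Rightarrow> ('a \<times> 'a) set"
  assumes equiv_E: "equiv M (E n)"
    and E_Suc: "E n \<subseteq> E (Suc n)"
    and UN_E: "(\<Union>n. E n) = M \<times> M"
begin

lemma E_mono: "m \<le> n \<Longrightarrow> E m \<subseteq> E n"
  by (rule lift_Suc_mono_le[of E]) (use E_Suc in auto)

lemma E_carrier: "(x, y) \<in> E n \<Longrightarrow> x \<in> M \<and> y \<in> M"
  using UN_E by blast

lemma E_refl: "x \<in> M \<Longrightarrow> (x, x) \<in> E n"
  using equiv_E[of n] by (auto elim!: equivE dest: refl_onD)

lemma E_sym: "(x, y) \<in> E n \<Longrightarrow> (y, x) \<in> E n"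
  using equiv_E[of n] by (auto elim!: equivE dest: symD)

lemma E_trans: "(x, y) \<in> E n \<Longrightarrow> (y, z) \<in> E n \<Longrightarrow> (x, z) \<in> E n"
  using equiv_E[of n] by (auto elim!: equivE dest: transD)

definition level_dist :: "'a \<Rightarrow> 'a \<Rightarrow> real" where
  "level_dist x y = real (LEAST n. (x, y) \<in> E n)"

lemma level_dist_le_iff:
  assumes "x \<in> M" "y \<in> M"
  shows "level_dist x y \<le> real n \<longleftrightarrow> (x, y) \<in> E n"
proof -
  obtain m where m: "(x, y) \<in> E m"
    using UN_E assms by blast
  show ?thesis
  proof
    assume "level_dist x y \<le> real n"
    then have "(LEAST n. (x, y) \<in> E n) \<le> n"
      by (simp add: level_dist_def)
    with LeastI[of "\<lambda>n. (x, y) \<in> E n", OF m] show "(x, y) \<in> E n"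
      using E_mono by blast
  qed (simp add: level_dist_def Least_le)
qed

lemma level_dist_le_floor:
  assumes "level_dist x y \<le> t"
  shows "level_dist x y \<le> real (nat \<lfloor>t\<rfloor>)"
  using assms unfolding level_dist_def by (intro of_nat_mono le_nat_floor)

lemma level_dist_commute: "level_dist x y = level_dist y x"
  unfolding level_dist_def by (metis E_sym)

lemma level_dist_ultra:
  assumes "x \<in> M" "y \<in> M" "z \<in> M"
  shows "level_dist x z \<le> max (level_dist x y) (level_dist y z)"
proof -
  obtain m n where mn: "level_dist x y = real m" "level_dist y z = real n"
    unfolding level_dist_def by blast
  then have "(x, y) \<in> E m" "(y, z) \<in> E n"
    using assms by (simp_all flip: level_dist_le_iff)
  then have "(x, z) \<in> E (max m n)"
    using E_mono[of m "max m n"] E_mono[of n "max m n"] by (auto intro: E_trans)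
  then show ?thesis
    using level_dist_le_iff[of x z "max m n"] assms mn by simp
qed

lemma Metric_space_level_dist:
  assumes "E 0 = Id_on M"
  shows "Metric_space M level_dist"
proof
  show nonneg: "0 \<le> level_dist x y" for x y
    by (simp add: level_dist_def)
  show "level_dist x y = level_dist y x" for x y
    by (rule level_dist_commute)
  show "level_dist x y = 0 \<longleftrightarrow> x = y" if "x \<in> M" "y \<in> M" for x y
    using level_dist_le_iff[OF that, of 0] nonneg[of x y] that assms by auto
  show "level_dist x z \<le> level_dist x y + level_dist y z" if "x \<in> M" "y \<in> M" "z \<in> M" for x y z
    using level_dist_ultra[OF that] nonneg[of x y] nonneg[of y z] by linarith
qed

lemma integral_ultrametric_level_dist:
  assumes "E 0 = Id_on M"
  shows "integral_ultrametric M level_dist"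
  using Metric_space_level_dist[OF assms] level_dist_ultra
  by (auto simp: integral_ultrametric_def) (simp add: level_dist_def)

lemma mcball_level_dist_subset:
  assumes "E 0 = Id_on M"
  shows "Metric_space.mcball M level_dist x t \<subseteq> E (nat \<lfloor>t\<rfloor>) `` {x}"
proof -
  interpret Metric_space M level_dist
    by (rule Metric_space_level_dist) fact
  show ?thesis
    using level_dist_le_floor level_dist_le_iff by fastforce
qed

lemma proper_metric_level_dist:
  assumes "E 0 = Id_on M" and fin: "\<And>n x. finite (E n `` {x})"
  shows "proper_metric M level_dist"
proof -
  interpret Metric_space M level_dist
    by (rule Metric_space_level_dist) fact
  show ?thesis
    unfolding proper_metric_def
  proof (intro allI impI)
    fix B assume "closedin mtopology B \<and> mbounded B"
    then obtain x t where "B \<subseteq> mcball x t"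
      unfolding mbounded_def by blast
    then have "finite B" "B \<subseteq> topspace mtopology"
      using mcball_level_dist_subset[OF assms(1), of x t] fin[of "nat \<lfloor>t\<rfloor>" x]
      by (auto dest: finite_subset)
    then show "compactin mtopology B"
      by (rule finite_imp_compactin[rotated])
  qed
qed

lemma bounded_geometry_level_dist:
  assumes "E 0 = Id_on M" and fin: "\<And>n x. finite (E n `` {x})" and le: "\<And>n x. card (E n `` {x}) \<le> b n"
  shows "bounded_geometry M level_dist"
  unfolding bounded_geometry_def
proof (rule exI[of _ 1], intro conjI exI[of _ "\<lambda>t. real (b (nat \<lfloor>t\<rfloor>))"] allI impI ballI)
  interpret Metric_space M level_dist
    by (rule Metric_space_level_dist) fact
  fix x t S
  assume "S \<subseteq> mcball x t \<and> (\<forall>a\<in>S. \<forall>b\<in>S. a \<noteq> b \<longrightarrow> 1 \<le> level_dist a b)"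
  then have S: "S \<subseteq> E (nat \<lfloor>t\<rfloor>) `` {x}"
    using mcball_level_dist_subset[OF assms(1)] by blast
  then show "finite S"
    using fin finite_subset by blast
  show "real (card S) \<le> real (b (nat \<lfloor>t\<rfloor>))"
    using card_mono[OF fin S] le[of "nat \<lfloor>t\<rfloor>" x] by simp
qed simp_all

text \<open>The classes of \<open>E n\<close> are bounded by \<open>n\<close>, and contain every set of diameter at most \<open>n\<close>
  that meets them.\<close>

lemma asdim_0_level_dist: "asdim_0 M level_dist"
  unfolding asdim_0_def
proof (intro allI impI)
  fix \<U> assume "uniformly_bounded_cover M level_dist \<U>"
  then obtain R where U: "\<Union>\<U> = M" and R: "\<And>U. U \<in> \<U> \<Longrightarrow> diameter_le level_dist U R"
    unfolding uniformly_bounded_cover_def by blast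
  define n where "n = nat \<lfloor>R\<rfloor>"
  \<comment> \<open>If \<open>M\<close> is empty there are no classes, but \<open>\<U>\<close> may still have the empty set as a member;
    hence the additional \<open>{}\<close>.\<close>
  let ?\<V> = "insert {} (M // E n)"
  have "uniformly_bounded_cover M level_dist ?\<V>"
    unfolding uniformly_bounded_cover_def
  proof
    show "\<Union>?\<V> = M"
      using Union_quotient[OF equiv_E] by simp
    have "level_dist x y \<le> real n" if "C \<in> M // E n" "x \<in> C" "y \<in> C" for C x y
      using quotient_eq_iff[OF equiv_E that(1,1) that(2,3)] E_carrier level_dist_le_iff by blast
    then show "\<exists>R. \<forall>V\<in>?\<V>. diameter_le level_dist V R"
      by (auto simp: diameter_le_def)
  qed
  moreover have "disjoint ?\<V>"
    using quotient_disj[OF equiv_E] by (fastforce simp: disjoint_def)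
  moreover have "refines \<U> ?\<V>"
    unfolding refines_def
  proof
    fix V assume V: "V \<in> \<U>"
    show "\<exists>W\<in>?\<V>. V \<subseteq> W"
    proof (cases "V = {}")
      case False
      then obtain x where x: "x \<in> V" "x \<in> M"
        using V U by blast
      have "(x, y) \<in> E n" if "y \<in> V" for y
      proof -
        have "level_dist x y \<le> R"
          using R[OF V] x that by (auto simp: diameter_le_def)
        then show ?thesis
          using level_dist_le_floor level_dist_le_iff U V x(2) that unfolding n_def by blast
      qed
      then have "V \<subseteq> E n `` {x}"
        by blast
      then show ?thesis
        using quotientI[OF x(2)] by blast
    qed auto
  qed
  ultimately show "\<exists>\<V>. uniformly_bounded_cover M level_dist \<V> \<and> disjoint \<V> \<and> refines \<U> \<V>"
    by blast
qed

end

section \<open>Spaces of asymptotic dimension zero\<close>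

text \<open>A disjoint cover refined by all pairs of points at distance at most \<open>R\<close> is the partition into
  classes of the desired relation.\<close>

lemma asdim_0_equiv:
  assumes "Metric_space X d" and "asdim_0 X d" and "0 \<le> R"
  obtains E S where "equiv X E"
    and "\<And>x y. x \<in> X \<Longrightarrow> y \<in> X \<Longrightarrow> d x y \<le> R \<Longrightarrow> (x, y) \<in> E"
    and "\<And>x y. (x, y) \<in> E \<Longrightarrow> d x y \<le> S"
proof -
  interpret Metric_space X d by fact
  let ?\<U> = "{{x, y} | x y. x \<in> X \<and> y \<in> X \<and> d x y \<le> R}"
  have "x \<in> \<Union>?\<U>" if "x \<in> X" for x
    by (rule UnionI[of "{x, x}"]) (use that \<open>0 \<le> R\<close> mdist_zero[OF that] in auto)
  then have "\<Union>?\<U> = X"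
    by auto
  moreover have "diameter_le d U R" if "U \<in> ?\<U>" for U
    using that \<open>0 \<le> R\<close> by (auto simp: diameter_le_def commute)
  ultimately have "uniformly_bounded_cover X d ?\<U>"
    unfolding uniformly_bounded_cover_def by blast
  then obtain \<V> where V: "uniformly_bounded_cover X d \<V>" "disjoint \<V>" "refines ?\<U> \<V>"
    using assms(2) unfolding asdim_0_def by blast
  then obtain S where S: "\<And>V. V \<in> \<V> \<Longrightarrow> diameter_le d V S" and cover: "\<Union>\<V> = X"
    unfolding uniformly_bounded_cover_def by blast
  let ?E = "{(x, y). \<exists>V\<in>\<V>. x \<in> V \<and> y \<in> V}"
  have "equiv X ?E"
  proof (rule equivI)
    show "trans ?E"
      using V(2) unfolding trans_def disjoint_def by blast
  qed (use cover in \<open>auto simp: refl_on_def sym_def\<close>)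
  moreover have "(x, y) \<in> ?E" if "x \<in> X" "y \<in> X" "d x y \<le> R" for x y
  proof -
    have "{x, y} \<in> ?\<U>"
      using that by blast
    then obtain V where "V \<in> \<V>" "{x, y} \<subseteq> V"
      using V(3) unfolding refines_def by meson
    then show ?thesis
      by blast
  qed
  moreover have "d x y \<le> S" if "(x, y) \<in> ?E" for x y
    using that S by (auto simp: diameter_le_def)
  ultimately show thesis
    by (rule that)
qed

text \<open>The previous lemma is iterated: the next threshold \<open>r (Suc k)\<close> exceeds the diameters of the
  classes of \<open>E k\<close>, so that \<open>E (Suc k)\<close> contains \<open>E k\<close>.\<close>

lemma asdim_0_filtration:
  assumes "Metric_space X d" and "asdim_0 X d" and "0 \<le> r0"
  obtains E r where "equiv_filtration X E" and "r 0 = r0" and "\<And>k. real k \<le> r k"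
    and "\<And>k x y. x \<in> X \<Longrightarrow> y \<in> X \<Longrightarrow> d x y \<le> r k \<Longrightarrow> (x, y) \<in> E k"
    and "\<And>k x y. (x, y) \<in> E k \<Longrightarrow> d x y \<le> r (Suc k)"
proof -
  interpret Metric_space X d by fact
  have "\<exists>E S. 0 \<le> R \<longrightarrow> equiv X E \<and> (\<forall>x\<in>X. \<forall>y\<in>X. d x y \<le> R \<longrightarrow> (x, y) \<in> E) \<and>
      (\<forall>x y. (x, y) \<in> E \<longrightarrow> d x y \<le> S)" for R
    using asdim_0_equiv[OF assms(1,2), of R] by metis
  then obtain F S where F: "\<And>R. 0 \<le> R \<Longrightarrow> equiv X (F R)"
    "\<And>R x y. 0 \<le> R \<Longrightarrow> x \<in> X \<Longrightarrow> y \<in> X \<Longrightarrow> d x y \<le> R \<Longrightarrow> (x, y) \<in> F R"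
    "\<And>R x y. 0 \<le> R \<Longrightarrow> (x, y) \<in> F R \<Longrightarrow> d x y \<le> S R"
    by metis
  define r where "r = rec_nat r0 (\<lambda>_ R. max (S R) R + 1)"
  have r_simps: "r 0 = r0" "\<And>k. r (Suc k) = max (S (r k)) (r k) + 1"
    by (simp_all add: r_def)
  have r_ge: "real k \<le> r k" for k
    by (induction k) (use assms(3) in \<open>auto simp: r_simps\<close>)
  have r_nonneg: "0 \<le> r k" for k
    using r_ge[of k] by linarith
  have near: "(x, y) \<in> F (r k)" if "x \<in> X" "y \<in> X" "d x y \<le> r k" for k x y
    using F(2)[OF r_nonneg] that by blast
  have far: "d x y \<le> r (Suc k)" if "(x, y) \<in> F (r k)" for k x y
    using F(3)[OF r_nonneg that] by (simp add: r_simps)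
  have carr: "x \<in> X \<and> y \<in> X" if "(x, y) \<in> F (r k)" for k x y
    using F(1)[OF r_nonneg] that by (auto elim!: equivE)
  have "equiv_filtration X (\<lambda>k. F (r k))"
  proof
    show "equiv X (F (r n))" for n
      by (rule F(1)[OF r_nonneg])
    show "F (r n) \<subseteq> F (r (Suc n))" for n
    proof (rule subrelI)
      fix x y assume xy: "(x, y) \<in> F (r n)"
      show "(x, y) \<in> F (r (Suc n))"
        using near[OF _ _ far[OF xy]] carr[OF xy] by blast
    qed
    have "(x, y) \<in> (\<Union>n. F (r n))" if "x \<in> X" "y \<in> X" for x y
    proof -
      have "d x y \<le> r (nat \<lceil>d x y\<rceil>)"
        by (rule order_trans[OF real_nat_ceiling_ge r_ge])
      then show ?thesis
        using near[OF that] by blast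
    qed
    then show "(\<Union>n. F (r n)) = X \<times> X"
      using carr by auto
  qed
  from that[OF this r_simps(1) r_ge near far] show thesis .
qed

text \<open>Every class of \<open>E (Suc k)\<close> splits into at most \<open>N k\<close> classes of \<open>E k\<close>. Classes are counted by
  sets of representatives, since these are the separated sets that bounded geometry bounds.\<close>

definition class_growth_le :: "(nat \<Rightarrow> ('a \<times> 'a) set) \<Rightarrow> (nat \<Rightarrow> nat) \<Rightarrow> bool" where
  "class_growth_le E N \<longleftrightarrow>
    (\<forall>k x S. S \<subseteq> E (Suc k) `` {x} \<longrightarrow> (\<forall>a\<in>S. \<forall>b\<in>S. a \<noteq> b \<longrightarrow> (a, b) \<notin> E k) \<longrightarrow>
       finite S \<and> card S \<le> N k)"

text \<open>The filtration starts at the scale \<open>\<epsilon>\<close> of bounded geometry. Points that are not \<open>E k\<close>-related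
  are then not \<open>E 0\<close>-related either, hence at distance at least \<open>\<epsilon>\<close>, so bounded geometry limits
  the number of representatives in a class, which is a subset of a ball.\<close>

lemma coarse_filtration:
  assumes "Metric_space X d" and "bounded_geometry X d" and "asdim_0 X d"
  obtains E r N where "equiv_filtration X E" and "class_growth_le E N" and "\<And>k. real k \<le> r k"
    and "\<And>k x y. x \<in> X \<Longrightarrow> y \<in> X \<Longrightarrow> d x y \<le> r k \<Longrightarrow> (x, y) \<in> E k"
    and "\<And>k x y. (x, y) \<in> E k \<Longrightarrow> d x y \<le> r (Suc k)"
proof -
  interpret Metric_space X d by fact
  obtain \<epsilon> c where ec: "\<epsilon> > 0" "\<forall>t\<ge>0. 0 \<le> (c :: real \<Rightarrow> real) t"
    and c: "\<And>x t S. x \<in> X \<Longrightarrow> t \<ge> 0 \<Longrightarrow> S \<subseteq> mcball x t \<Longrightarrow>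
           (\<forall>a\<in>S. \<forall>b\<in>S. a \<noteq> b \<longrightarrow> \<epsilon> \<le> d a b) \<Longrightarrow> finite S \<and> real (card S) \<le> c t"
    using assms(2) unfolding bounded_geometry_def by metis
  obtain E r where E: "equiv_filtration X E" and r: "r 0 = \<epsilon>" "\<And>k. real k \<le> r k"
    and near: "\<And>k x y. x \<in> X \<Longrightarrow> y \<in> X \<Longrightarrow> d x y \<le> r k \<Longrightarrow> (x, y) \<in> E k"
    and far: "\<And>k x y. (x, y) \<in> E k \<Longrightarrow> d x y \<le> r (Suc k)"
    using asdim_0_filtration[OF assms(1,3), of \<epsilon>] \<open>\<epsilon> > 0\<close> by (metis less_imp_le)
  interpret equiv_filtration X E by fact
  have "finite S \<and> card S \<le> nat \<lfloor>c (r (Suc (Suc k)))\<rfloor>"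
    if S: "S \<subseteq> E (Suc k) `` {x}" "\<forall>a\<in>S. \<forall>b\<in>S. a \<noteq> b \<longrightarrow> (a, b) \<notin> E k" for k x S
  proof (cases "S = {}")
    case False
    then have "x \<in> X"
      using S(1) E_carrier by blast
    moreover have "S \<subseteq> mcball x (r (Suc (Suc k)))"
      using S(1) E_carrier far by auto
    moreover have "\<epsilon> \<le> d a b" if "a \<in> S" "b \<in> S" "a \<noteq> b" for a b
    proof -
      have "(a, b) \<notin> E 0"
        using S(2) that E_mono[of 0 k] by blast
      moreover have "a \<in> X" "b \<in> X"
        using S(1) that E_carrier by blast+
      ultimately show ?thesis
        using near[of a b 0] r(1) by fastforce
    qed
    moreover have "0 \<le> r (Suc (Suc k))"
      using r(2)[of "Suc (Suc k)"] by linarith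
    ultimately have "finite S \<and> real (card S) \<le> c (r (Suc (Suc k)))"
      by (intro c) auto
    then show ?thesis
      by (simp add: le_nat_floor)
  qed simp
  then have "class_growth_le E (\<lambda>k. nat \<lfloor>c (r (Suc (Suc k)))\<rfloor>)"
    unfolding class_growth_le_def by simp
  from that[OF E this r(2) near far] show thesis .
qed

text \<open>Each class of \<open>B\<close> has at most \<open>card T\<close> subclasses, so these inject into \<open>T\<close>. The injections
  for different classes of \<open>B\<close> are chosen independently.\<close>

lemma class_labelling:
  assumes A: "equiv X A" and B: "equiv X B"
    and bound: "\<And>x S. S \<subseteq> B `` {x} \<Longrightarrow> (\<forall>a\<in>S. \<forall>b\<in>S. a \<noteq> b \<longrightarrow> (a, b) \<notin> A) \<Longrightarrow>
                  finite S \<and> card S \<le> card T"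
    and "A \<subseteq> B" and "finite T"
  obtains \<phi> where "\<And>x. x \<in> X \<Longrightarrow> \<phi> x \<in> T" and "\<And>x y. (x, y) \<in> A \<Longrightarrow> \<phi> x = \<phi> y"
    and "\<And>x y. (x, y) \<in> B \<Longrightarrow> \<phi> x = \<phi> y \<Longrightarrow> (x, y) \<in> A"
proof -
  define rep where "rep x = (SOME y. y \<in> A `` {x})" for x
  have rep: "(x, rep x) \<in> A" if "x \<in> X" for x
    unfolding rep_def using someI[of "\<lambda>y. y \<in> A `` {x}" x] equiv_class_self[OF A that] by auto
  have rep_cong: "rep x = rep y" if "(x, y) \<in> A" for x y
    using equiv_class_eq[OF A that] by (simp add: rep_def)
  have rep_eq: "(x, y) \<in> A" if "x \<in> X" "y \<in> X" "rep x = rep y" for x y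
    using rep[OF that(1)] rep[OF that(2)] that(3) A
    by (metis equivE symD transD)
  have "\<exists>h. inj_on h (rep ` (B `` {x})) \<and> h ` (rep ` (B `` {x})) \<subseteq> T" for x
  proof -
    let ?S = "rep ` (B `` {x})"
    have sub: "B `` {x} \<subseteq> X"
      using B by (auto elim!: equivE)
    have "?S \<subseteq> B `` {x}"
      using rep sub \<open>A \<subseteq> B\<close> B by (auto elim!: equivE intro: transD dest: subsetD)
    moreover have "\<forall>a\<in>?S. \<forall>b\<in>?S. a \<noteq> b \<longrightarrow> (a, b) \<notin> A"
      using rep_cong rep sub by (metis (no_types, lifting) imageE subsetD)
    ultimately have "finite ?S" "card ?S \<le> card T"
      using bound by auto
    then show ?thesis
      using card_le_inj[OF _ \<open>finite T\<close>] by blast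
  qed
  then have "\<forall>C\<in>X // B. \<exists>h. inj_on h (rep ` C) \<and> h ` (rep ` C) \<subseteq> T"
    by (auto elim!: quotientE)
  then obtain h where h: "\<And>C. C \<in> X // B \<Longrightarrow> inj_on (h C) (rep ` C) \<and> h C ` (rep ` C) \<subseteq> T"
    by metis
  define \<phi> where "\<phi> x = h (B `` {x}) (rep x)" for x
  show thesis
  proof
    show "\<phi> x \<in> T" if "x \<in> X" for x
      using h[OF quotientI[OF that]] equiv_class_self[OF B that] by (auto simp: \<phi>_def)
    show "\<phi> x = \<phi> y" if "(x, y) \<in> A" for x y
      using that rep_cong equiv_class_eq[OF B, of x y] \<open>A \<subseteq> B\<close> by (auto simp: \<phi>_def)
    show "(x, y) \<in> A" if "(x, y) \<in> B" "\<phi> x = \<phi> y" for x y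
    proof -
      have X: "x \<in> X" "y \<in> X"
        using that B by (auto elim!: equivE)
      have "inj_on (h (B `` {x})) (rep ` (B `` {x}))"
        using h[OF quotientI[OF X(1)]] by blast
      moreover have "h (B `` {x}) (rep x) = h (B `` {x}) (rep y)"
        using that equiv_class_eq[OF B that(1)] by (simp add: \<phi>_def)
      ultimately have "rep x = rep y"
        using that(1) equiv_class_self[OF B X(1)] by (auto dest: inj_onD)
      then show ?thesis
        using rep_eq X by blast
    qed
  qed
qed


section \<open>Chains of finite subgroups\<close>

text \<open>\<open>rcong H\<close> relates elements of the same left coset of \<open>H\<close>; its invariance under left
  multiplication is what drives the computations with products below.\<close>

lemma (in group) rcong_left_cancel:
  assumes "c \<in> carrier G" "a \<in> carrier G" "b \<in> carrier G"
  shows "(c \<otimes> a, c \<otimes> b) \<in> rcong H \<longleftrightarrow> (a, b) \<in> rcong H"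
proof -
  have "inv c \<otimes> (c \<otimes> b) = b"
    using assms by (simp flip: m_assoc)
  then have "inv (c \<otimes> a) \<otimes> (c \<otimes> b) = inv a \<otimes> b"
    using assms by (simp add: inv_mult_group m_assoc)
  then show ?thesis
    using assms by (simp add: r_congruent_def)
qed

lemma (in group) rcong_of_mem:
  assumes "subgroup H G" "a \<in> H" "b \<in> H"
  shows "(a, b) \<in> rcong H"
  using assms subgroup.mem_carrier[OF assms(1)]
  by (simp add: r_congruent_def subgroup.m_closed subgroup.m_inv_closed)

lemma (in group) rcong_mult_right:
  assumes "subgroup H G" "a \<in> carrier G" "p \<in> H"
  shows "(a, a \<otimes> p) \<in> rcong H"
  using rcong_left_cancel[of a \<one> p] rcong_of_mem[OF assms(1) _ assms(3), of \<one>] assms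
    subgroup.mem_carrier[OF assms(1)] subgroup.one_closed[OF assms(1)] by simp

locale subgroup_chain = group G for G (structure) +
  fixes K :: "nat \<Rightarrow> 'a set"
  assumes subgroup_K: "subgroup (K n) G"
    and finite_K: "finite (K n)"
    and K_strict: "K n \<subset> K (Suc n)"
    and K_0: "K 0 = {\<one>}"
    and carrier_eq: "carrier G = (\<Union>n. K n)"
begin

lemma K_mono: "m \<le> n \<Longrightarrow> K m \<subseteq> K n"
  by (rule lift_Suc_mono_le[of K]) (use K_strict in auto)

lemma K_carrier: "K n \<subseteq> carrier G"
  using carrier_eq by blast

sublocale equiv_filtration "carrier G" "\<lambda>n. rcong (K n)"
proof
  show "equiv (carrier G) (rcong (K n))" for n
    by (rule subgroup.equiv_rcong[OF subgroup_K is_group])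
  show "rcong (K n) \<subseteq> rcong (K (Suc n))" for n
    using K_strict by (auto simp: r_congruent_def)
  have "\<exists>n. inv x \<otimes> y \<in> K n" if "x \<in> carrier G" "y \<in> carrier G" for x y
  proof -
    have "inv x \<otimes> y \<in> carrier G"
      using that by simp
    then show ?thesis
      by (subst (asm) carrier_eq) blast
  qed
  then show "(\<Union>n. rcong (K n)) = carrier G \<times> carrier G"
    by (auto simp: r_congruent_def)
qed

lemma rcong_K_0: "rcong (K 0) = Id_on (carrier G)"
proof -
  have "x = y" if "x \<in> carrier G" "y \<in> carrier G" "inv x \<otimes> y = \<one>" for x y
  proof -
    have "y = x \<otimes> (inv x \<otimes> y)"
      using that(1,2) by (simp flip: m_assoc)
    with that show ?thesis
      by simp
  qed
  then show ?thesis
    by (auto simp: r_congruent_def K_0)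
qed

lemma rcong_class:
  shows "finite ((rcong (K n)) `` {x})" and "card ((rcong (K n)) `` {x}) \<le> card (K n)"
proof -
  have "y \<in> (\<lambda>h. x \<otimes> h) ` K n" if "(x, y) \<in> rcong (K n)" for y
    using that by (intro image_eqI[of _ _ "inv x \<otimes> y"]) (auto simp: r_congruent_def simp flip: m_assoc)
  then have sub: "(rcong (K n)) `` {x} \<subseteq> (\<lambda>h. x \<otimes> h) ` K n"
    by blast
  then show "finite ((rcong (K n)) `` {x})"
    using finite_K finite_surj by blast
  show "card ((rcong (K n)) `` {x}) \<le> card (K n)"
    using surj_card_le[OF finite_K sub] .
qed

text \<open>Choose \<open>t i \<in> K (Suc i) - K i\<close>. For \<open>n \<le> i < j\<close> the elements \<open>t i\<close> and \<open>t j\<close> lie in different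
  left cosets of \<open>K j\<close>, as \<open>K j\<close> contains the first but not the second; all the more so for the
  smaller subgroup \<open>K n\<close>.\<close>

lemma many_cosets:
  "\<exists>m>n. \<exists>T\<subseteq>K m. finite T \<and> card T = N \<and> (\<forall>a\<in>T. \<forall>b\<in>T. a \<noteq> b \<longrightarrow> (a, b) \<notin> rcong (K n))"
proof -
  have "\<exists>x. x \<in> K (Suc i) \<and> x \<notin> K i" for i
    using K_strict[of i] by blast
  then obtain t where t: "\<And>i. t i \<in> K (Suc i)" "\<And>i. t i \<notin> K i"
    by metis
  have ncong: "(t i, t j) \<notin> rcong (K n)" if "n \<le> i" "i < j" for i j
  proof
    assume "(t i, t j) \<in> rcong (K n)"
    then have c: "t i \<in> carrier G" "t j \<in> carrier G" "inv (t i) \<otimes> t j \<in> K j"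
      using K_mono[of n j] that by (auto simp: r_congruent_def)
    moreover have "t i \<in> K j"
      using t(1)[of i] K_mono[of "Suc i" j] that by auto
    ultimately have "t i \<otimes> (inv (t i) \<otimes> t j) \<in> K j"
      using subgroup.m_closed[OF subgroup_K] by blast
    then show False
      using c t(2)[of j] by (simp flip: m_assoc)
  qed
  have refl: "(t i, t i) \<in> rcong (K n)" for i
    using E_refl K_carrier t(1)[of i] by blast
  have "inj_on t {n..<n + N}"
    by (rule linorder_inj_onI) (use ncong refl in \<open>force+\<close>)
  then have "card (t ` {n..<n + N}) = N"
    by (simp add: card_image)
  moreover have "t ` {n..<n + N} \<subseteq> K (Suc (n + N))"
  proof (rule image_subsetI)
    fix i assume "i \<in> {n..<n + N}"
    then show "t i \<in> K (Suc (n + N))"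
      using t(1)[of i] K_mono[of "Suc i" "Suc (n + N)"] by auto
  qed
  moreover have "(a, b) \<notin> rcong (K n)" if "a \<in> t ` {n..<n + N}" "b \<in> t ` {n..<n + N}" "a \<noteq> b" for a b
  proof -
    note ab = that
    obtain i j where "a = t i" "b = t j" "n \<le> i" "n \<le> j"
      using ab(1,2) by force
    with \<open>a \<noteq> b\<close> have "i < j \<or> j < i"
      by (metis linorder_neqE_nat)
    with \<open>a = t i\<close> \<open>b = t j\<close> \<open>n \<le> i\<close> \<open>n \<le> j\<close> show ?thesis
      using ncong[of i j] ncong[of j i] E_sym by auto
  qed
  ultimately show ?thesis
    by (intro exI[of _ "Suc (n + N)"] conjI exI[of _ "t ` {n..<n + N}"]) auto
qed

lemma sparse_subchain:
  obtains idx T where "strict_mono idx" and "\<And>k. T k \<subseteq> K (idx (Suc k))"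
    and "\<And>k. finite (T k)" and "\<And>k. card (T k) = N k"
    and "\<And>k a b. a \<in> T k \<Longrightarrow> b \<in> T k \<Longrightarrow> (a, b) \<in> rcong (K (idx k)) \<Longrightarrow> a = b"
proof -
  obtain m T where m: "\<And>n N. m n N > n" and T: "\<And>n N. T n N \<subseteq> K (m n N)"
    "\<And>n N. finite (T n N)" "\<And>n N. card (T n N) = N"
    "\<And>n N a b. a \<in> T n N \<Longrightarrow> b \<in> T n N \<Longrightarrow> a \<noteq> b \<Longrightarrow> (a, b) \<notin> rcong (K n)"
    using many_cosets by metis
  define idx where "idx = rec_nat 0 (\<lambda>k i. m i (N k))"
  have idx_Suc: "idx (Suc k) = m (idx k) (N k)" for k
    by (simp add: idx_def)
  show thesis
  proof (rule that[of idx "\<lambda>k. T (idx k) (N k)"])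
    show "strict_mono idx"
      using m by (simp add: strict_mono_Suc_iff idx_Suc)
    show "a = b" if "a \<in> T (idx k) (N k)" "b \<in> T (idx k) (N k)" "(a, b) \<in> rcong (K (idx k))" for k a b
      using T(4) that by blast
  qed (simp_all add: T idx_Suc)
qed

text \<open>The factor with the highest index is leftmost: if each \<open>s j\<close> is in the \<open>(j+1)\<close>-st subgroup of
  a chain, then the factors below \<open>k\<close> do not affect the left coset of the \<open>k\<close>-th subgroup.\<close>

primrec desc_prod :: "(nat \<Rightarrow> 'a) \<Rightarrow> nat \<Rightarrow> 'a" where
  "desc_prod s 0 = \<one>"
| "desc_prod s (Suc k) = s k \<otimes> desc_prod s k"

lemma desc_prod_mem:
  assumes "mono idx" and "\<And>k. s k \<in> K (idx (Suc k))"
  shows "desc_prod s k \<in> K (idx k)"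
proof (induction k)
  case (Suc k)
  have "K (idx k) \<subseteq> K (idx (Suc k))"
    using assms(1) by (intro K_mono) (simp add: mono_def)
  with Suc assms(2) show ?case
    using subgroup.m_closed[OF subgroup_K] by auto
qed (simp add: subgroup.one_closed[OF subgroup_K])

lemma desc_prod_eventually_one:
  assumes "m \<le> M" and "\<And>j. m \<le> j \<Longrightarrow> s j = \<one>" and "\<And>k. desc_prod s k \<in> carrier G"
  shows "desc_prod s M = desc_prod s m"
  using assms(1) by (induction M rule: dec_induct) (use assms in auto)

lemma desc_prod_cancel_common:
  assumes "k \<le> M" and "\<And>j. k \<le> j \<Longrightarrow> s j = s' j" and "\<And>j. s j \<in> carrier G"
    and "\<And>j. desc_prod s j \<in> carrier G" and "\<And>j. desc_prod s' j \<in> carrier G"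
  shows "(desc_prod s M, desc_prod s' M) \<in> rcong H \<longleftrightarrow> (desc_prod s k, desc_prod s' k) \<in> rcong H"
  using assms(1)
proof (induction M rule: dec_induct)
  case (step M)
  have "s' M = s M" "s M \<in> carrier G"
    using assms(2)[OF step.hyps(1)] assms(3)[of M] by simp_all
  then show ?case
    using step.IH assms(4,5) by (simp add: rcong_left_cancel)
qed simp

text \<open>The heart of the argument. The label \<open>\<tau> x k\<close> tells the \<open>E k\<close>-class of \<open>x\<close> from the others within
  its \<open>E (Suc k)\<close>-class. If \<open>x\<close> and \<open>y\<close> are \<open>E l\<close>-related, then their labels agree from level \<open>l\<close> on,
  and cancelling them reduces the comparison of \<open>f x\<close> and \<open>f y\<close> to the partial products below
  \<open>l\<close>. For \<open>l = k\<close> these are in \<open>K (idx k)\<close>. If \<open>x\<close> and \<open>y\<close> are not \<open>E k\<close>-related, take \<open>l\<close> maximal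
  such that they are not \<open>E l\<close>-related; the labels at level \<open>l\<close> are then in different cosets of
  \<open>K (idx l)\<close>, and multiplying them on the right by elements of \<open>K (idx l)\<close> does not change this.\<close>

lemma filtration_embedding:
  assumes "equiv_filtration X E" and growth: "class_growth_le E N"
  obtains f idx where "strict_mono idx" and "f \<in> X \<rightarrow> carrier G"
    and "\<And>k x y. x \<in> X \<Longrightarrow> y \<in> X \<Longrightarrow> (x, y) \<in> E k \<longleftrightarrow> (f x, f y) \<in> rcong (K (idx k))"
proof (cases "X = {}")
  case True
  then show thesis
    using that[of id "\<lambda>x. \<one>"] by (simp add: strict_mono_def)
next
  case False
  then obtain x0 where x0: "x0 \<in> X"
    by blast
  interpret X: equiv_filtration X E by fact
  obtain idx T where idx: "strict_mono idx" and T: "\<And>k. T k \<subseteq> K (idx (Suc k))"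
    "\<And>k. finite (T k)" "\<And>k. card (T k) = N k"
    "\<And>k a b. a \<in> T k \<Longrightarrow> b \<in> T k \<Longrightarrow> (a, b) \<in> rcong (K (idx k)) \<Longrightarrow> a = b"
    using sparse_subchain by blast
  have mono: "mono idx"
    using idx by (rule strict_mono_mono)
  have "\<exists>\<phi>. (\<forall>x\<in>X. \<phi> x \<in> T k) \<and> (\<forall>x y. (x, y) \<in> E k \<longrightarrow> \<phi> x = \<phi> y) \<and>
          (\<forall>x y. (x, y) \<in> E (Suc k) \<and> \<phi> x = \<phi> y \<longrightarrow> (x, y) \<in> E k)" for k
  proof -
    have "finite S \<and> card S \<le> card (T k)"
      if "S \<subseteq> E (Suc k) `` {x}" "\<forall>a\<in>S. \<forall>b\<in>S. a \<noteq> b \<longrightarrow> (a, b) \<notin> E k" for x S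
      using growth that unfolding class_growth_le_def T(3) by blast
    note labelling = class_labelling[OF X.equiv_E X.equiv_E this X.E_Suc T(2)]
    show ?thesis
    proof (rule labelling)
      fix \<phi> assume \<phi>: "\<And>x. x \<in> X \<Longrightarrow> \<phi> x \<in> T k" "\<And>x y. (x, y) \<in> E k \<Longrightarrow> \<phi> x = \<phi> y"
        "\<And>x y. (x, y) \<in> E (Suc k) \<Longrightarrow> \<phi> x = \<phi> y \<Longrightarrow> (x, y) \<in> E k"
      show ?thesis
        by (intro exI[of _ \<phi>] conjI ballI allI impI) (use \<phi> in blast)+
    qed
  qed
  then obtain \<phi> where \<phi>_T: "\<And>k x. x \<in> X \<Longrightarrow> \<phi> k x \<in> T k"
    and \<phi>_cong: "\<And>k x y. (x, y) \<in> E k \<Longrightarrow> \<phi> k x = \<phi> k y"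
    and \<phi>_sep: "\<And>k x y. (x, y) \<in> E (Suc k) \<Longrightarrow> \<phi> k x = \<phi> k y \<Longrightarrow> (x, y) \<in> E k"
    by metis
  have \<phi>_K: "\<phi> k x \<in> K (idx (Suc k))" if "x \<in> X" for k x
    using \<phi>_T[OF that] T(1) by blast
  \<comment> \<open>Left multiplication preserves the coset relations, so dividing by the label of the base point
    loses nothing; it makes the labels of each \<open>x\<close> equal to \<open>\<one>\<close> from some level on.\<close>
  define \<tau> where "\<tau> x k = inv (\<phi> k x0) \<otimes> \<phi> k x" for x k
  have \<tau>_K: "\<tau> x k \<in> K (idx (Suc k))" if "x \<in> X" for x k
    unfolding \<tau>_def using \<phi>_K[OF that] \<phi>_K[OF x0] subgroup_K
    by (simp add: subgroup.m_closed subgroup.m_inv_closed)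
  have \<tau>_carrier: "\<tau> x k \<in> carrier G" if "x \<in> X" for x k
    using \<tau>_K[OF that] K_carrier by blast
  have \<tau>_cong: "\<tau> x j = \<tau> y j" if "(x, y) \<in> E k" "k \<le> j" for x y j k
    using \<phi>_cong[of x y j] X.E_mono[OF that(2)] that(1) by (auto simp: \<tau>_def)
  have \<tau>_one: "\<tau> x0 j = \<one>" for j
    using \<phi>_K[OF x0, of j] K_carrier unfolding \<tau>_def by (intro l_inv) blast
  have \<tau>_sep: "(\<tau> x k, \<tau> y k) \<notin> rcong (K (idx k))" if "(x, y) \<in> E (Suc k)" "(x, y) \<notin> E k" for x y k
  proof -
    have X: "x \<in> X" "y \<in> X"
      using that(1) X.E_carrier by auto
    have "(\<phi> k x, \<phi> k y) \<notin> rcong (K (idx k))"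
      using T(4)[OF \<phi>_T[OF X(1)] \<phi>_T[OF X(2)]] \<phi>_sep that by blast
    then show ?thesis
      unfolding \<tau>_def using \<phi>_K[OF x0] \<phi>_K[OF X(1)] \<phi>_K[OF X(2)] K_carrier
      by (subst rcong_left_cancel) blast+
  qed
  have prod_K: "desc_prod (\<tau> x) k \<in> K (idx k)" if "x \<in> X" for x k
    by (rule desc_prod_mem[OF mono \<tau>_K[OF that]])
  have prod_carrier: "desc_prod (\<tau> x) k \<in> carrier G" if "x \<in> X" for x k
    using prod_K[OF that] K_carrier by blast
  define f where "f x = desc_prod (\<tau> x) (LEAST m. (x, x0) \<in> E m)" for x
  have f_eq: "\<exists>m. \<forall>M\<ge>m. f x = desc_prod (\<tau> x) M" if "x \<in> X" for x
  proof -
    let ?m = "LEAST m. (x, x0) \<in> E m"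
    have "\<exists>m. (x, x0) \<in> E m"
      using X.UN_E that x0 by blast
    then have "(x, x0) \<in> E ?m"
      by (rule LeastI_ex)
    then have "\<tau> x j = \<one>" if "?m \<le> j" for j
      using \<tau>_cong[OF _ that] \<tau>_one by simp
    then have "\<forall>M\<ge>?m. f x = desc_prod (\<tau> x) M"
      using desc_prod_eventually_one[of ?m _ "\<tau> x"] prod_carrier[OF that] unfolding f_def by metis
    then show ?thesis
      by blast
  qed
  show thesis
  proof (rule that[OF idx])
    show "f \<in> X \<rightarrow> carrier G"
      using prod_carrier by (simp add: f_def)
    fix k x y assume X: "x \<in> X" "y \<in> X"
    obtain mx my where m: "\<forall>M\<ge>mx. f x = desc_prod (\<tau> x) M" "\<forall>M\<ge>my. f y = desc_prod (\<tau> y) M"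
      using f_eq X by metis
    have common: "(f x, f y) \<in> rcong H \<longleftrightarrow> (desc_prod (\<tau> x) l, desc_prod (\<tau> y) l) \<in> rcong H"
      if "(x, y) \<in> E l" for l H
    proof -
      let ?M = "max l (max mx my)"
      have "f x = desc_prod (\<tau> x) ?M" "f y = desc_prod (\<tau> y) ?M"
        using m by auto
      then show ?thesis
        using desc_prod_cancel_common[of l ?M "\<tau> x" "\<tau> y"] \<tau>_cong[OF that] \<tau>_carrier prod_carrier X
        by simp
    qed
    show "(x, y) \<in> E k \<longleftrightarrow> (f x, f y) \<in> rcong (K (idx k))"
    proof
      assume "(x, y) \<in> E k"
      then show "(f x, f y) \<in> rcong (K (idx k))"
        using common rcong_of_mem[OF subgroup_K prod_K[OF X(1)] prod_K[OF X(2)]] by blast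
    next
      assume cong: "(f x, f y) \<in> rcong (K (idx k))"
      show "(x, y) \<in> E k"
      proof (rule ccontr)
        assume nE: "(x, y) \<notin> E k"
        obtain n where n: "(x, y) \<in> E n"
          using X.UN_E X by blast
        with nE have "\<not> n \<le> k"
          using X.E_mono by blast
        \<comment> \<open>Between \<open>k\<close> and \<open>n\<close> there is a level \<open>l\<close> at which the classes of \<open>x\<close> and \<open>y\<close> merge.\<close>
        with n nE obtain l where l: "k \<le> l" "(x, y) \<notin> E l" "(x, y) \<in> E (Suc l)"
          using dec_induct[of k n "\<lambda>l. (x, y) \<notin> E l"] by (metis nat_le_linear)
        have "(f x, f y) \<in> rcong (K (idx l))"
          using cong E_mono[OF monoD[OF mono l(1)]] by blast
        then have "(\<tau> x l \<otimes> desc_prod (\<tau> x) l, \<tau> y l \<otimes> desc_prod (\<tau> y) l) \<in> rcong (K (idx l))"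
          using common[OF l(3)] by simp
        then have "(\<tau> x l, \<tau> y l) \<in> rcong (K (idx l))"
          using rcong_mult_right[OF subgroup_K \<tau>_carrier prod_K] X E_sym E_trans by meson
        with \<tau>_sep[OF l(3,2)] show False ..
      qed
    qed
  qed
qed

lemma coarsely_embeds_level_dist:
  assumes "Metric_space X \<delta>" and "bounded_geometry X \<delta>" and "asdim_0 X \<delta>"
  shows "coarsely_embeds X \<delta> (carrier G) level_dist"
proof -
  obtain E r N where E: "equiv_filtration X E" "class_growth_le E N" and r: "\<And>k. real k \<le> r k"
    and near: "\<And>k x y. x \<in> X \<Longrightarrow> y \<in> X \<Longrightarrow> \<delta> x y \<le> r k \<Longrightarrow> (x, y) \<in> E k"
    and far: "\<And>k x y. (x, y) \<in> E k \<Longrightarrow> \<delta> x y \<le> r (Suc k)"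
    using coarse_filtration[OF assms] by metis
  obtain f idx where idx: "strict_mono idx" and f: "f \<in> X \<rightarrow> carrier G"
    and iff: "\<And>k x y. x \<in> X \<Longrightarrow> y \<in> X \<Longrightarrow> (x, y) \<in> E k \<longleftrightarrow> (f x, f y) \<in> rcong (K (idx k))"
    using filtration_embedding[OF E] by metis
  have iff': "(x, y) \<in> E k \<longleftrightarrow> level_dist (f x) (f y) \<le> real (idx k)" if "x \<in> X" "y \<in> X" for x y k
    using iff[OF that] level_dist_le_iff f that by (simp add: Pi_iff)
  have "uniformly_bornologous X \<delta> level_dist f"
    unfolding uniformly_bornologous_def
  proof (intro allI impI)
    fix R :: real
    have "R \<le> r (nat \<lceil>R\<rceil>)"
      by (rule order_trans[OF real_nat_ceiling_ge r])
    then have "level_dist (f x) (f y) \<le> real (idx (nat \<lceil>R\<rceil>))" if "x \<in> X" "y \<in> X" "\<delta> x y \<le> R" for x y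
      using near[OF that(1,2)] iff'[OF that(1,2)] that(3) by (meson order_trans)
    then have "\<forall>x\<in>X. \<forall>y\<in>X. \<delta> x y \<le> R \<longrightarrow> level_dist (f x) (f y) \<le> real (idx (nat \<lceil>R\<rceil>)) + 1"
      by (simp add: add_increasing2)
    then show "\<exists>S>0. \<forall>x\<in>X. \<forall>y\<in>X. \<delta> x y \<le> R \<longrightarrow> level_dist (f x) (f y) \<le> S"
      by (intro exI[of _ "real (idx (nat \<lceil>R\<rceil>)) + 1"]) auto
  qed
  moreover have "uniformly_proper X \<delta> (carrier G) level_dist f"
    unfolding uniformly_proper_iff[OF Metric_space_level_dist[OF rcong_K_0] f]
  proof (intro allI impI)
    fix R :: real
    let ?k = "nat \<lceil>R\<rceil>"
    have "R \<le> real (idx ?k)"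
      using strict_mono_imp_increasing[OF idx, of ?k] by linarith
    then have "\<forall>x\<in>X. \<forall>y\<in>X. level_dist (f x) (f y) \<le> R \<longrightarrow> \<delta> x y \<le> r (Suc ?k)"
      using iff' far by (meson order_trans)
    moreover have "0 < r (Suc ?k)"
      using r[of "Suc ?k"] by linarith
    ultimately show "\<exists>S>0. \<forall>x\<in>X. \<forall>y\<in>X. level_dist (f x) (f y) \<le> R \<longrightarrow> \<delta> x y \<le> S"
      by blast
  qed
  ultimately show ?thesis
    using f unfolding coarsely_embeds_def coarse_embedding_def by blast
qed

lemma universal_space_level_dist: "universal_space TYPE('x) (carrier G) level_dist"
  unfolding universal_space_def
proof (intro conjI allI impI)
  show "bounded_geometry (carrier G) level_dist"
    by (rule bounded_geometry_level_dist[OF rcong_K_0, where b = "\<lambda>n. card (K n)"]) (rule rcong_class)+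
qed (simp_all add: asdim_0_level_dist coarsely_embeds_level_dist)

end

section \<open>The universal ultrametric on a locally finite group\<close>

lemma coarsely_embeds_countable_nat:
  assumes "Metric_space M d" and "countable M"
  obtains N :: "nat set" and g where "g \<in> N \<rightarrow> M" and "inj_on g N"
    and "coarsely_embeds M d N (\<lambda>m n. d (g m) (g n))"
proof
  let ?e = "to_nat_on M"
  show g: "from_nat_into M \<in> ?e ` M \<rightarrow> M" "inj_on (from_nat_into M) (?e ` M)"
  proof -
    show "from_nat_into M \<in> ?e ` M \<rightarrow> M"
      using from_nat_into_to_nat_on[OF assms(2)] by auto
    show "inj_on (from_nat_into M) (?e ` M)"
      by (rule inj_on_inverseI[of _ ?e]) (use from_nat_into_to_nat_on[OF assms(2)] in auto)
  qed
  show "coarsely_embeds M d (?e ` M) (\<lambda>m n. d (from_nat_into M m) (from_nat_into M n))"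
    by (rule coarsely_embeds_isometry[OF Metric_space_pullback[OF assms(1) g], of ?e])
      (use assms(2) in auto)
qed

theorem theorem6p9:
  fixes G :: "('a, 'm) monoid_scheme" and H :: "nat \<Rightarrow> 'a set"
  assumes "group G"
    and "countable (carrier G)"
    and "\<And>i. i \<ge> 1 \<Longrightarrow> subgroup (H i) G \<and> finite (H i)"
    and "\<And>i. i \<ge> 1 \<Longrightarrow> H i \<subset> H (Suc i)"
    and "carrier G = (\<Union>i\<in>{1..}. H i)"
  shows "(\<exists>d. integral_ultrametric (carrier G) d \<and> proper_metric (carrier G) d \<and>
              universal_space TYPE(nat) (carrier G) d) \<and>
         (\<forall>d. integral_ultrametric (carrier G) d \<and> proper_metric (carrier G) d \<and>
              universal_space TYPE(nat) (carrier G) d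
                \<longrightarrow> universal_space TYPE('b) (carrier G) d)"
proof -
  interpret group G by fact
  \<comment> \<open>Replacing \<open>H 1\<close> by the trivial subgroup keeps the inclusion into \<open>H 2\<close> strict, even if
    \<open>H 1\<close> is itself trivial.\<close>
  define K where "K n = (if n = 0 then {\<one>\<^bsub>G\<^esub>} else H (Suc n))" for n
  have chain: "subgroup_chain G K"
  proof (intro subgroup_chain.intro subgroup_chain_axioms.intro)
    show "group G"
      by (rule is_group)
    show "subgroup (K n) G" "finite (K n)" for n
      using assms(3)[of "Suc n"] by (auto simp: K_def triv_subgroup)
    have "\<one>\<^bsub>G\<^esub> \<in> H 1"
      using assms(3)[of 1] by (simp add: subgroup.one_closed)
    then have "{\<one>\<^bsub>G\<^esub>} \<subseteq> H 1"
      by blast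
    also have "H 1 \<subset> H 2"
      using assms(4)[of 1] by (simp add: numeral_2_eq_2)
    finally have "{\<one>\<^bsub>G\<^esub>} \<subset> H 2" .
    then show "K n \<subset> K (Suc n)" for n
      using assms(4)[of "Suc n"] by (auto simp: K_def numeral_2_eq_2)
    show "K 0 = {\<one>\<^bsub>G\<^esub>}"
      by (simp add: K_def)
    have "\<exists>n. x \<in> K n" if "x \<in> carrier G" for x
    proof -
      obtain i where i: "i \<ge> 1" "x \<in> H i"
        using \<open>x \<in> carrier G\<close> unfolding assms(5) by auto
      then have "x \<in> K i"
        using assms(4)[of i] by (auto simp: K_def)
      then show ?thesis ..
    qed
    moreover have "K n \<subseteq> carrier G" for n
      unfolding assms(5) using \<open>\<one>\<^bsub>G\<^esub> \<in> H 1\<close> by (auto simp: K_def)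
    ultimately show "carrier G = (\<Union>n. K n)"
      by blast
  qed
  interpret subgroup_chain G K by (fact chain)
  let ?d = level_dist
  have d: "Metric_space (carrier G) ?d"
    by (rule Metric_space_level_dist[OF rcong_K_0])
  have "integral_ultrametric (carrier G) ?d" "proper_metric (carrier G) ?d"
    "universal_space TYPE(nat) (carrier G) ?d"
    by (rule integral_ultrametric_level_dist[OF rcong_K_0] universal_space_level_dist
        proper_metric_level_dist[OF rcong_K_0 rcong_class(1)])+
  moreover have "universal_space TYPE('b) (carrier G) d'"
    if "integral_ultrametric (carrier G) d'" "universal_space TYPE(nat) (carrier G) d'" for d'
  proof -
    have d': "Metric_space (carrier G) d'"
      using that(1) by (simp add: integral_ultrametric_def)
    obtain N :: "nat set" and g where g: "g \<in> N \<rightarrow> carrier G" "inj_on g N"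
      and emb: "coarsely_embeds (carrier G) ?d N (\<lambda>m n. ?d (g m) (g n))"
      by (rule coarsely_embeds_countable_nat[OF d assms(2)])
    note N = Metric_space_pullback[OF d g]
    have d_geom: "bounded_geometry (carrier G) ?d" "asdim_0 (carrier G) ?d"
      using universal_space_level_dist[where 'x = nat] by (simp_all add: universal_space_def)
    have "coarsely_embeds N (\<lambda>m n. ?d (g m) (g n)) (carrier G) d'"
      using that(2) N bounded_geometry_pullback[OF d g d_geom(1)] asdim_0_pullback[OF d g(1) d_geom(2)]
      by (simp add: universal_space_def)
    then have "coarsely_embeds (carrier G) ?d (carrier G) d'"
      by (rule coarsely_embeds_trans[OF N d' emb])
    then have "coarsely_embeds X \<delta> (carrier G) d'"
      if "Metric_space X \<delta>" "bounded_geometry X \<delta>" "asdim_0 X \<delta>" for X :: "'b set" and \<delta>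
      by (rule coarsely_embeds_trans[OF d d' coarsely_embeds_level_dist[OF that]])
    with that(2) show ?thesis
      by (simp add: universal_space_def)
  qed
  ultimately show ?thesis
    by blast
qed

end
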